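(* The only conical constant angle surfaces in $\mathbb{R}^3$ are circular cones; that is, every conical surface that is a constant angle surface is a circular cone (or an open part of one).
   Context: Conical surface with vertex at the origin: a surface parameterized by $r(s,v)=v\,\alpha(s)$, where the generating curve $\alpha$ may be taken (after reparameterization) to be a smooth curve on the unit sphere parameterized by arc length, i.e. $|\alpha(s)|=1$ and $|\alpha'(s)|=1$; the surface is considered away from its vertex ($v\neq0$). Constant angle surface: a surface in $\mathbb{R}^3$ whose unit normal $N$ makes a constant angle $\theta\in[0,\pi)$ with a fixed direction $k$ at every point, i.e. $\langle N,k\rangle=\cos\theta$ with $k$ a unit vector. Circular cone: in the usual sense, the surface swept out by the lines through a vertex that make a fixed angle in $(0,\frac{\pi}{2})$ with a fixed axis through the vertex.
   Formalization: Surfaces contained in a plane are excluded: a plane through the vertex (generating curve an arc of a great circle) is a conical constant angle surface with θ = 0 but is not part of a circular cone of angle in (0, π/2). *)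

theory Defs
  imports "HOL-Analysis.Analysis"
begin

(* The sequence A lists the derivatives of \<alpha> of all orders. *)
definition smooth_curve_on :: "real set \<Rightarrow> (real \<Rightarrow> real ^ 3) \<Rightarrow> bool" where
  "smooth_curve_on I \<alpha> \<longleftrightarrow>
    (\<exists>A :: nat \<Rightarrow> real \<Rightarrow> real ^ 3. A 0 = \<alpha> \<and>
      (\<forall>n. \<forall>s\<in>I. (A n has_vector_derivative A (Suc n) s) (at s)))"

(* The vertex is the origin. The set J of values of v may be any nonempty open set avoiding 0,
   so that one nappe (J = {0<..}), both nappes (J = - {0}) and bounded pieces are all covered. *)
definition conical_surface :: "(real \<times> real \<Rightarrow> real ^ 3) \<Rightarrow> (real \<times> real) set \<Rightarrow> bool" where
  "conical_surface r D \<longleftrightarrow>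
    (\<exists>\<alpha> I J. is_interval I \<and> open I \<and> I \<noteq> {} \<and>
       smooth_curve_on I \<alpha> \<and>
       (\<forall>s\<in>I. norm (\<alpha> s) = 1 \<and> norm (vector_derivative \<alpha> (at s)) = 1) \<and>
       open J \<and> J \<noteq> {} \<and> 0 \<notin> J \<and>
       D = I \<times> J \<and>
       (\<forall>s\<in>I. \<forall>v\<in>J. r (s, v) = v *\<^sub>R \<alpha> s))"

(* N is a function of the parameters, as the surface may intersect itself. The sign of N may be
   chosen independently on each connected component of the parameter domain. *)
definition unit_normal_field ::
    "(real \<times> real \<Rightarrow> real ^ 3) \<Rightarrow> (real \<times> real) set \<Rightarrow> (real \<times> real \<Rightarrow> real ^ 3) \<Rightarrow> bool" where
  "unit_normal_field r D N \<longleftrightarrow>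
    continuous_on D N \<and>
    (\<forall>(s, v)\<in>D. norm (N (s, v)) = 1 \<and>
       N (s, v) \<bullet> vector_derivative (\<lambda>s'. r (s', v)) (at s) = 0 \<and>
       N (s, v) \<bullet> vector_derivative (\<lambda>v'. r (s, v')) (at v) = 0)"

definition constant_angle_surface :: "(real \<times> real \<Rightarrow> real ^ 3) \<Rightarrow> (real \<times> real) set \<Rightarrow> bool" where
  "constant_angle_surface r D \<longleftrightarrow>
    (\<exists>N k \<theta>. unit_normal_field r D N \<and> norm k = 1 \<and> 0 \<le> \<theta> \<and> \<theta> < pi \<and>
       (\<forall>p\<in>D. N p \<bullet> k = cos \<theta>))"

(* The union of the lines through p whose angle with the axis p + \<real> a is \<phi> (for a unit vector a
   and 0 < \<phi> < pi / 2); each line has a unit direction u on the side of a. *)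
definition circular_cone :: "real ^ 3 \<Rightarrow> real ^ 3 \<Rightarrow> real \<Rightarrow> (real ^ 3) set" where
  "circular_cone p a \<phi> = {p + t *\<^sub>R u | t u. norm u = 1 \<and> u \<bullet> a = cos \<phi>}"

(* A plane minus one of its points is a conical surface (\<alpha> is a great circle) with constant unit
   normal, but it is not part of a circular cone of angle less than pi / 2. *)
lemma planar_conical_constant_angle_surface:
  defines "r \<equiv> \<lambda>(s, v). v *\<^sub>R (vector [cos s, sin s, 0] :: real ^ 3)"
      and "D \<equiv> UNIV \<times> (- {0})"
  shows "conical_surface r D" "constant_angle_surface r D"
    and "\<And>p a \<phi>. norm a = 1 \<Longrightarrow> 0 < \<phi> \<Longrightarrow> \<phi> < pi / 2 \<Longrightarrow> \<not> r ` D \<subseteq> circular_cone p a \<phi>"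
proof -
  define \<alpha> where "\<alpha> = (\<lambda>s. cos s *\<^sub>R axis 1 1 + sin s *\<^sub>R axis 2 1 :: real ^ 3)"
  have r: "r (s, v) = v *\<^sub>R \<alpha> s" for s v
    by (simp add: r_def \<alpha>_def vec_eq_iff forall_3 axis_def)
  have d: "((\<lambda>s. \<alpha> (s + c)) has_vector_derivative \<alpha> (s + c + pi / 2)) (at s)" for s c
    unfolding \<alpha>_def has_vector_derivative_def
    by (auto intro!: derivative_eq_intros simp: fun_eq_iff cos_add sin_add algebra_simps)
  have d0: "(\<alpha> has_vector_derivative \<alpha> (s + pi / 2)) (at s)" for s
    using d[of 0 s] by simp
  have n: "norm (\<alpha> s) = 1" for s
    by (simp add: \<alpha>_def norm_eq_sqrt_inner inner_vec_def sum_3 axis_def flip: power2_eq_square)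
  have "smooth_curve_on UNIV \<alpha>"
    unfolding smooth_curve_on_def
    by (rule exI[of _ "\<lambda>n s. \<alpha> (s + of_nat n * (pi / 2))"])
      (use d[of "of_nat n * (pi / 2)" s for n s] in \<open>auto simp: algebra_simps add_divide_distrib\<close>)
  then show "conical_surface r D"
    unfolding conical_surface_def
    by (intro exI[of _ \<alpha>] exI[of _ UNIV] exI[of _ "- {0}"])
      (auto simp: D_def r n vector_derivative_at[OF d0] is_interval_univ)
  have z: "\<alpha> s \<bullet> axis 3 1 = 0" for s
    by (simp add: \<alpha>_def inner_vec_def sum_3 axis_def)
  have "unit_normal_field r D (\<lambda>_. axis 3 1)"
  proof -
    have "vector_derivative (\<lambda>s. v *\<^sub>R \<alpha> s) (at s) = v *\<^sub>R \<alpha> (s + pi / 2)" for s v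
      by (rule vector_derivative_at, rule bounded_linear.has_vector_derivative[OF _ d0])
        (rule bounded_linear_scaleR_right)
    moreover have "vector_derivative (\<lambda>v. v *\<^sub>R \<alpha> s) (at v) = \<alpha> s" for s v
      by (rule vector_derivative_at) (auto intro!: derivative_eq_intros simp: has_vector_derivative_def)
    ultimately show ?thesis
      by (auto simp: unit_normal_field_def r z inner_commute[of "axis 3 1"] norm_axis_1)
  qed
  then show "constant_angle_surface r D"
    unfolding constant_angle_surface_def
    by (intro exI[of _ "\<lambda>_. axis 3 1"] exI[of _ "axis 3 1"] exI[of _ 0])
      (auto simp: norm_axis_1 inner_axis_axis)
  fix p a :: "real ^ 3" and \<phi> :: real
  assume a: "norm a = 1" "0 < \<phi>" "\<phi> < pi / 2"
  have c: "cos \<phi> \<noteq> 0"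
    using a cos_gt_zero[of \<phi>] by simp
  obtain s where s: "\<alpha> s \<bullet> a = 0"
  proof (cases "a $ 2 = 0")
    case True
    then show ?thesis
      by (intro that[of "pi / 2"]) (simp add: \<alpha>_def inner_vec_def sum_3 axis_def)
  next
    case False
    define s where "s = arctan (- (a $ 1 / a $ 2))"
    have "cos s \<noteq> 0" "tan s = - (a $ 1 / a $ 2)"
      by (auto simp only: s_def cos_arctan_not_zero tan_arctan)
    then have "sin s * a $ 2 = - (cos s * a $ 1)"
      using False by (simp add: tan_def field_simps)
    then show ?thesis
      by (intro that[of s]) (simp add: \<alpha>_def inner_vec_def sum_3 axis_def)
  qed
  show "\<not> r ` D \<subseteq> circular_cone p a \<phi>"
  proof
    assume sub: "r ` D \<subseteq> circular_cone p a \<phi>"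
    have q: "(p \<bullet> a)\<^sup>2 = (cos \<phi>)\<^sup>2 * (v\<^sup>2 - 2 * v * (\<alpha> s \<bullet> p) + (norm p)\<^sup>2)" if "v \<noteq> 0" for v
    proof -
      have "r (s, v) \<in> circular_cone p a \<phi>"
        using sub that by (auto simp: D_def)
      then obtain t u where tu: "v *\<^sub>R \<alpha> s = p + t *\<^sub>R u" "norm u = 1" "u \<bullet> a = cos \<phi>"
        by (auto simp: r circular_cone_def)
      then have e: "v *\<^sub>R \<alpha> s - p = t *\<^sub>R u"
        by simp
      have "- (p \<bullet> a) = (v *\<^sub>R \<alpha> s - p) \<bullet> a"
        by (simp add: inner_diff_left s)
      also have "\<dots> = t * cos \<phi>"
        by (simp add: e tu)
      finally have 1: "(p \<bullet> a)\<^sup>2 = t\<^sup>2 * (cos \<phi>)\<^sup>2"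
        by (metis power2_minus power_mult_distrib)
      have "t\<^sup>2 = (norm (v *\<^sub>R \<alpha> s - p))\<^sup>2"
        by (simp add: e tu)
      also have "\<dots> = v\<^sup>2 * (norm (\<alpha> s))\<^sup>2 - 2 * v * (\<alpha> s \<bullet> p) + (norm p)\<^sup>2"
        by (simp only: power2_norm_eq_inner) (simp add: inner_diff inner_commute power2_eq_square)
      finally show ?thesis
        using 1 by (simp add: n)
    qed
    show False
    proof -
      let ?f = "\<lambda>v. v\<^sup>2 - 2 * v * (\<alpha> s \<bullet> p) + (norm p)\<^sup>2"
      have "(cos \<phi>)\<^sup>2 * ?f 1 = (cos \<phi>)\<^sup>2 * ?f 2" "(cos \<phi>)\<^sup>2 * ?f 1 = (cos \<phi>)\<^sup>2 * ?f 3"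
        using q[of 1] q[of 2] q[of 3] by (metis zero_neq_one zero_neq_numeral)+
      then have "?f 1 = ?f 2" "?f 1 = ?f 3"
        using c by (simp_all only: mult_cancel_left power_eq_0_iff) simp_all
      then show ?thesis
        by simp
    qed
  qed
qed

end

theory Submission
  imports Defs
begin

text \<open>
  Along a ruling of the cone \<open>(s, v) \<mapsto> v \<alpha>(s)\<close> the tangent plane is spanned by \<open>\<alpha>(s)\<close> and
  \<open>T(s) = \<alpha>'(s)\<close>, so up to sign the unit normal is \<open>M(s) = \<alpha>(s) \<times> T(s)\<close>, whatever \<open>v\<close> is. The vectors
  \<open>\<alpha>, T, M\<close> form an orthonormal frame with \<open>T' = \<kappa> M - \<alpha>\<close> and \<open>M' = - \<kappa> T\<close>, where \<open>\<kappa>\<close> is the geodesic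
  curvature of \<open>\<alpha>\<close> on the sphere.

  If the normal makes a constant angle with \<open>k\<close>, then \<open>(M \<bullet> k)\<^sup>2\<close> is a constant \<open>C\<close>, and differentiating
  gives \<open>\<kappa> (T \<bullet> k) = 0\<close>. So there are two kinds of points: those with \<open>\<kappa> = 0\<close>, and those where \<open>T\<close> is
  orthogonal to \<open>k\<close>. On the open set where \<open>\<kappa> \<noteq> 0\<close>, differentiating \<open>T \<bullet> k = 0\<close> gives
  \<open>\<kappa> (M \<bullet> k) = \<alpha> \<bullet> k\<close>, whence \<open>\<kappa>\<^sup>2 = (1 - C) / C\<close>; here \<open>C \<noteq> 0\<close>, because \<open>k\<close> cannot be
  orthogonal to the whole frame. Thus \<open>\<kappa>\<^sup>2\<close> is a continuous function with at most two values, and it is constant as the parameter interval is connected: the two kinds cannot be mixed.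

  If \<open>\<kappa>\<close> vanishes, then \<open>M\<close> is constant and the surface lies in the plane orthogonal to it
  (\<open>planar_if_geodesic\<close>). Otherwise \<open>\<alpha> \<bullet> k\<close> is a constant strictly between \<open>0\<close> and \<open>1\<close> in absolute value
  (\<open>constant_nonzero_height\<close>), so \<open>\<alpha>\<close> runs in a circle of latitude and the surface lies in the circular cone
  over that circle. That it is open in the cone (\<open>openin_circular_cone\<close>) comes from solving the equation
  that \<open>\<alpha>\<close> satisfies: a unit speed curve in the circle is a uniform rotation
  (\<open>latitude_circle_parametrization\<close>), and the rotation angle of a point of the cone can be recovered
  from it continuously.
\<close>

section \<open>Derivatives and orthonormal frames\<close>

lemma has_vector_derivative_inner:
  fixes f g :: "real \<Rightarrow> 'a::real_inner"
  assumes "(f has_vector_derivative f') (at s)" "(g has_vector_derivative g') (at s)"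
  shows "((\<lambda>s. f s \<bullet> g s) has_vector_derivative (f s \<bullet> g' + f' \<bullet> g s)) (at s)"
  by (rule bounded_bilinear.has_vector_derivative[OF bounded_bilinear_inner assms])

lemma has_vector_derivative_cross3:
  assumes "(f has_vector_derivative f') (at s)" "(g has_vector_derivative g') (at s)"
  shows "((\<lambda>s. cross3 (f s) (g s)) has_vector_derivative (cross3 (f s) g' + cross3 f' (g s))) (at s)"
  using bilinear_cross
  by (intro bounded_bilinear.has_vector_derivative[OF _ assms])
    (simp add: bilinear_conv_bounded_bilinear)

text \<open>Turns every constant scalar product along the curve into an equation between derivatives.\<close>

lemma has_vector_derivative_locally_constant:
  assumes "open I" "s \<in> I" "\<And>t. t \<in> I \<Longrightarrow> f t = c" "(f has_vector_derivative f') (at s)"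
  shows "f' = 0"
proof -
  have "(f has_vector_derivative 0) (at s)"
    by (rule has_vector_derivative_transform_within_open[where f = "\<lambda>_. c" and S = I])
      (use assms in auto)
  then show ?thesis
    using assms(4) vector_derivative_unique_at by blast
qed

lemma constant_on_interval_zero_vector_derivative:
  fixes f :: "real \<Rightarrow> 'a::real_normed_vector"
  assumes "is_interval I" "\<And>s. s \<in> I \<Longrightarrow> (f has_vector_derivative 0) (at s)" "s \<in> I" "t \<in> I"
  shows "f s = f t"
proof -
  have "\<exists>c. \<forall>s\<in>I. f s = c"
  proof (rule has_derivative_zero_constant)
    show "convex I"
      using assms(1) by (simp add: is_interval_convex)
    show "(f has_derivative (\<lambda>h. 0)) (at s within I)" if "s \<in> I" for s
      using assms(2)[OF that] has_derivative_at_withinI by (auto simp: has_vector_derivative_def)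
  qed
  then show ?thesis
    using assms by auto
qed

text \<open>By Lagrange's formula \<open>x \<times> (p \<times> q) = 0\<close> if \<open>x\<close> is orthogonal to \<open>p\<close> and \<open>q\<close>, so \<open>x\<close> is parallel to
  \<open>p \<times> q\<close>; but it is orthogonal to it as well.\<close>

lemma eq_zero_if_orthogonal_to_cross3_frame:
  assumes "norm p = 1" "norm q = 1" "p \<bullet> q = 0" "x \<bullet> p = 0" "x \<bullet> q = 0" "x \<bullet> cross3 p q = 0"
  shows "x = 0"
proof -
  have "cross3 x (cross3 p q) = 0"
    using assms by (simp add: Lagrange)
  moreover have "norm (cross3 p q) = 1"
    using norm_cross[of p q] assms by (simp add: power2_eq_1_iff)
      (smt (verit) norm_ge_zero)
  ultimately show ?thesis
    using norm_and_cross_eq_0[of x "cross3 p q"] assms by auto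
qed

lemma cross3_frame_expansion:
  assumes "norm p = 1" "norm q = 1" "p \<bullet> q = 0"
  shows "x = (x \<bullet> p) *\<^sub>R p + (x \<bullet> q) *\<^sub>R q + (x \<bullet> cross3 p q) *\<^sub>R cross3 p q" (is "x = ?y")
proof -
  have pq: "p \<bullet> p = 1" "q \<bullet> q = 1" "q \<bullet> p = 0"
    using assms by (simp_all add: norm_eq_1 inner_commute)
  have m: "cross3 p q \<bullet> cross3 p q = 1"
    using pq assms by (simp add: dot_cross)
  have "x - ?y = 0"
    by (rule eq_zero_if_orthogonal_to_cross3_frame[OF assms])
      (use assms pq m in \<open>simp_all add: inner_diff_left inner_add_left dot_cross_self\<close>)
  then show ?thesis by simp
qed

section \<open>The moving frame of a spherical curve\<close>

text \<open>\<open>T\<close> and \<open>A\<close> are the velocity and the acceleration. They are parameters, so that all derivatives can be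
  stated as derivative relations.\<close>

locale unit_speed_spherical_curve =
  fixes \<alpha> T A :: "real \<Rightarrow> real ^ 3" and I :: "real set"
  assumes interval: "is_interval I" and open_I: "open I"
    and deriv_\<alpha>: "s \<in> I \<Longrightarrow> (\<alpha> has_vector_derivative T s) (at s)"
    and deriv_T: "s \<in> I \<Longrightarrow> (T has_vector_derivative A s) (at s)"
    and cont_A: "continuous_on I A"
    and norm_\<alpha>: "s \<in> I \<Longrightarrow> norm (\<alpha> s) = 1"
    and norm_T: "s \<in> I \<Longrightarrow> norm (T s) = 1"
begin

text \<open>The unit normal, up to sign, of the cone over \<open>\<alpha>\<close> along the ruling through \<open>\<alpha> s\<close>.\<close>

definition M :: "real \<Rightarrow> real ^ 3" where "M s = cross3 (\<alpha> s) (T s)"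

text \<open>The geodesic curvature of \<open>\<alpha>\<close> as a curve on the unit sphere.\<close>

definition \<kappa> :: "real \<Rightarrow> real" where "\<kappa> s = A s \<bullet> M s"

lemma inner_frame:
  assumes s: "s \<in> I"
  shows "\<alpha> s \<bullet> \<alpha> s = 1" "T s \<bullet> T s = 1" "M s \<bullet> M s = 1"
    "\<alpha> s \<bullet> T s = 0" "T s \<bullet> \<alpha> s = 0" "\<alpha> s \<bullet> M s = 0" "M s \<bullet> \<alpha> s = 0" "T s \<bullet> M s = 0" "M s \<bullet> T s = 0"
proof -
  show *: "\<alpha> s \<bullet> \<alpha> s = 1" "T s \<bullet> T s = 1"
    using s norm_\<alpha> norm_T by (auto simp: norm_eq_1)
  have "\<alpha> s \<bullet> T s + T s \<bullet> \<alpha> s = 0"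
    by (rule has_vector_derivative_locally_constant[OF open_I s, where f = "\<lambda>s. \<alpha> s \<bullet> \<alpha> s" and c = 1])
      (use s norm_\<alpha> in \<open>auto intro!: has_vector_derivative_inner deriv_\<alpha> simp: norm_eq_1\<close>)
  then show **: "\<alpha> s \<bullet> T s = 0" "T s \<bullet> \<alpha> s = 0"
    by (auto simp: inner_commute)
  show "M s \<bullet> M s = 1"
    by (simp add: M_def dot_cross * **)
  show "\<alpha> s \<bullet> M s = 0" "M s \<bullet> \<alpha> s = 0" "T s \<bullet> M s = 0" "M s \<bullet> T s = 0"
    by (simp_all add: M_def dot_cross_self)
qed

lemma inner_A:
  assumes s: "s \<in> I"
  shows "A s \<bullet> \<alpha> s = -1" "A s \<bullet> T s = 0"
proof -
  have "T s \<bullet> A s + A s \<bullet> T s = 0"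
    by (rule has_vector_derivative_locally_constant[OF open_I s, where f = "\<lambda>s. T s \<bullet> T s" and c = 1])
      (use s in \<open>auto intro!: has_vector_derivative_inner deriv_T simp: inner_frame\<close>)
  then show "A s \<bullet> T s = 0"
    by (simp add: inner_commute)
  have "T s \<bullet> T s + A s \<bullet> \<alpha> s = 0"
    by (rule has_vector_derivative_locally_constant[OF open_I s, where f = "\<lambda>s. T s \<bullet> \<alpha> s" and c = 0])
      (use s in \<open>auto intro!: has_vector_derivative_inner deriv_T deriv_\<alpha> simp: inner_frame(5)\<close>)
  then show "A s \<bullet> \<alpha> s = -1"
    using s by (simp add: inner_frame)
qed

lemma frame_expansion:
  assumes "s \<in> I"
  shows "x = (x \<bullet> \<alpha> s) *\<^sub>R \<alpha> s + (x \<bullet> T s) *\<^sub>R T s + (x \<bullet> M s) *\<^sub>R M s"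
  unfolding M_def
  by (rule cross3_frame_expansion) (use assms norm_\<alpha> norm_T inner_frame in auto)

lemma height_if_tangent_orthogonal:
  assumes "s \<in> I" "norm k = 1" "T s \<bullet> k = 0"
  shows "(\<alpha> s \<bullet> k)\<^sup>2 = 1 - (M s \<bullet> k)\<^sup>2"
proof -
  have "k = (\<alpha> s \<bullet> k) *\<^sub>R \<alpha> s + (M s \<bullet> k) *\<^sub>R M s"
    using frame_expansion[OF assms(1), of k] assms(3) by (simp add: inner_commute)
  then have "k \<bullet> k = (\<alpha> s \<bullet> k)\<^sup>2 + (M s \<bullet> k)\<^sup>2"
    by (metis inner_add_left inner_scaleR_left power2_eq_square)
  then show ?thesis
    using assms(2) by (simp add: norm_eq_1)
qed

lemma A_eq: "s \<in> I \<Longrightarrow> A s = \<kappa> s *\<^sub>R M s - \<alpha> s"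
  using frame_expansion[of s "A s"] by (simp add: inner_A \<kappa>_def)

lemma deriv_M:
  assumes s: "s \<in> I"
  shows "(M has_vector_derivative - \<kappa> s *\<^sub>R T s) (at s)"
proof -
  have "cross3 (\<alpha> s) (A s) = - \<kappa> s *\<^sub>R T s"
    using s by (simp add: A_eq cross_mult_right Cross3.right_diff_distrib M_def Lagrange inner_frame)
  then show ?thesis
    using has_vector_derivative_cross3[OF deriv_\<alpha>[OF s] deriv_T[OF s]]
    by (simp add: M_def[abs_def])
qed

lemma continuous_on_\<kappa>: "continuous_on I \<kappa>"
proof -
  have "continuous_on I M"
    using deriv_M by (meson continuous_at_imp_continuous_on has_vector_derivative_continuous)
  then show ?thesis
    unfolding \<kappa>_def[abs_def] by (intro continuous_intros cont_A)
qed

text \<open>A unit normal is \<open>\<plusminus> M s\<close>. Squaring removes the sign, which a normal field may choose.\<close>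

lemma normal_angle:
  assumes s: "s \<in> I" and N: "norm n = 1" "n \<bullet> \<alpha> s = 0" "n \<bullet> T s = 0"
  shows "(M s \<bullet> k)\<^sup>2 = (n \<bullet> k)\<^sup>2"
proof -
  have n: "n = (n \<bullet> M s) *\<^sub>R M s"
    using frame_expansion[OF s, of n] N by simp
  then have "n \<bullet> n = (n \<bullet> M s)\<^sup>2"
    by (metis inner_scaleR_right power2_eq_square)
  moreover have "n \<bullet> k = (n \<bullet> M s) * (M s \<bullet> k)"
    by (metis n inner_scaleR_left)
  ultimately show ?thesis
    using N(1) by (simp add: norm_eq_1 power_mult_distrib)
qed

section \<open>Constant angle\<close>

text \<open>Here \<open>M\<close> is constant, and every \<open>\<alpha> s\<close> is orthogonal to it: \<open>\<alpha>\<close> runs in a great circle.\<close>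

lemma planar_if_geodesic:
  assumes "\<And>s. s \<in> I \<Longrightarrow> \<kappa> s = 0"
  shows "coplanar {v *\<^sub>R \<alpha> s | s v. s \<in> I}"
proof (cases "I = {}")
  case False
  then obtain s0 where s0: "s0 \<in> I" by auto
  have "v *\<^sub>R \<alpha> s \<in> affine hull {0, \<alpha> s0, T s0}" if s: "s \<in> I" for s v
  proof -
    have "M s0 = M s"
      by (rule constant_on_interval_zero_vector_derivative[OF interval _ s0 s])
        (use deriv_M assms in fastforce)
    then have "\<alpha> s \<bullet> M s0 = 0"
      using inner_frame(6)[OF s] by simp
    then have "\<alpha> s = (\<alpha> s \<bullet> \<alpha> s0) *\<^sub>R \<alpha> s0 + (\<alpha> s \<bullet> T s0) *\<^sub>R T s0"
      using frame_expansion[OF s0, of "\<alpha> s"] by simp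
    moreover have "(\<alpha> s \<bullet> \<alpha> s0) *\<^sub>R \<alpha> s0 + (\<alpha> s \<bullet> T s0) *\<^sub>R T s0 \<in> span {0, \<alpha> s0, T s0}"
      by (intro span_add span_mul) (auto intro: span_base)
    ultimately have "v *\<^sub>R \<alpha> s \<in> span {0, \<alpha> s0, T s0}"
      by (metis span_mul)
    then show ?thesis
      by (subst affine_hull_span_0) (auto intro: hull_inc)
  qed
  then show ?thesis
    unfolding coplanar_def by blast
qed (simp add: coplanar_empty)

text \<open>The heart of the proof. The hypothesis gives \<open>\<kappa> (T \<bullet> k) = 0\<close>, which makes \<open>\<alpha> \<bullet> k\<close> locally constant
  wherever \<open>\<kappa> \<noteq> 0\<close>. One such parameter \<open>s1\<close> is enough: at all of them \<open>\<kappa>\<^sup>2\<close> has the same nonzero value, so by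
  continuity and connectedness \<open>\<kappa>\<close> has no zero at all. The bounds on \<open>b\<close> hold because
  \<open>C = 1 - b\<^sup>2\<close> and both \<open>C\<close> and \<open>1 - C\<close> are nonzero.\<close>

lemma constant_nonzero_height:
  assumes k: "norm k = 1"
    and C: "\<And>s. s \<in> I \<Longrightarrow> (M s \<bullet> k)\<^sup>2 = C"
    and s1: "s1 \<in> I" "\<kappa> s1 \<noteq> 0"
  obtains b where "\<And>s. s \<in> I \<Longrightarrow> \<alpha> s \<bullet> k = b" "b \<noteq> 0" "b\<^sup>2 < 1"
proof -
  have dM: "((\<lambda>s. M s \<bullet> k) has_vector_derivative - (\<kappa> s * (T s \<bullet> k))) (at s)" if "s \<in> I" for s
    using has_vector_derivative_inner[OF deriv_M[OF that] has_vector_derivative_const[of k]] by simp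
  have \<kappa>T: "\<kappa> s * (T s \<bullet> k) = 0" if s: "s \<in> I" for s
  proof (cases "C = 0")
    case True
    have "- (\<kappa> s * (T s \<bullet> k)) = 0"
      by (rule has_vector_derivative_locally_constant[OF open_I s _ dM[OF s], of 0]) (use C True in auto)
    then show ?thesis by simp
  next
    case False
    have "(M s \<bullet> k) \<bullet> - (\<kappa> s * (T s \<bullet> k)) + - (\<kappa> s * (T s \<bullet> k)) \<bullet> (M s \<bullet> k) = 0"
      by (rule has_vector_derivative_locally_constant[OF open_I s _
            has_vector_derivative_inner[OF dM[OF s] dM[OF s]], of C])
        (use C in \<open>auto simp: power2_eq_square\<close>)
    then show ?thesis
      using C[OF s] False by auto
  qed
  have \<kappa>2: "(\<kappa> s)\<^sup>2 * C = 1 - C" if s: "s \<in> I" "\<kappa> s \<noteq> 0" for s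
  proof -
    define U where "U = {t \<in> I. \<kappa> t \<noteq> 0}"
    have "open U"
    proof -
      have "U = I \<inter> \<kappa> -` (- {0})" by (auto simp: U_def)
      then show ?thesis
        using continuous_open_preimage[OF continuous_on_\<kappa> open_I, of "- {0}"] by auto
    qed
    have "A s \<bullet> k = 0"
      by (rule has_vector_derivative_locally_constant[OF \<open>open U\<close>, of s "\<lambda>s. T s \<bullet> k" 0])
       (use s \<kappa>T has_vector_derivative_inner[OF deriv_T[OF s(1)] has_vector_derivative_const[of k]]
         in \<open>auto simp: U_def\<close>)
    then have 1: "\<kappa> s * (M s \<bullet> k) = \<alpha> s \<bullet> k"
      using s by (simp add: A_eq inner_diff_left)
    have "T s \<bullet> k = 0"
      using \<kappa>T s by auto
    then have "(\<alpha> s \<bullet> k)\<^sup>2 = 1 - C"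
      using height_if_tangent_orthogonal[OF s(1) k] C[OF s(1)] by simp
    then show ?thesis
      using C[OF s(1)] by (metis 1 power_mult_distrib)
  qed
  have C0: "C > 0" "C < 1"
  proof -
    have "C \<noteq> 0" using \<kappa>2[OF s1] by auto
    then show "C > 0" using C[OF s1(1)] by (metis zero_le_power2 order_le_less)
    then show "C < 1" using \<kappa>2[OF s1] s1 by (smt (verit) mult_pos_pos zero_less_power2)
  qed
  have ne: "\<kappa> s \<noteq> 0" if s: "s \<in> I" for s
  proof -
    have "(\<lambda>s. (\<kappa> s)\<^sup>2) constant_on I"
    proof (rule continuous_finite_range_constant)
      show "connected I" using interval by (simp add: is_interval_connected)
      show "continuous_on I (\<lambda>s. (\<kappa> s)\<^sup>2)" by (intro continuous_intros continuous_on_\<kappa>)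
      have "(\<lambda>s. (\<kappa> s)\<^sup>2) ` I \<subseteq> {0, (1 - C) / C}"
        using \<kappa>2 C0 by (auto simp: field_simps)
      then show "finite ((\<lambda>s. (\<kappa> s)\<^sup>2) ` I)"
        using finite_subset by blast
    qed
    then show ?thesis
      using s s1 unfolding constant_on_def by (metis power_eq_0_iff zero_power2)
  qed
  then have Tk: "T s \<bullet> k = 0" if "s \<in> I" for s
    using \<kappa>T that by auto
  have const: "\<alpha> s \<bullet> k = \<alpha> s1 \<bullet> k" if "s \<in> I" for s
    by (rule constant_on_interval_zero_vector_derivative[OF interval _ that s1(1)])
     (use has_vector_derivative_inner[OF deriv_\<alpha> has_vector_derivative_const[of k]] Tk in fastforce)
  have "(\<alpha> s1 \<bullet> k)\<^sup>2 = 1 - C"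
    using height_if_tangent_orthogonal[OF s1(1) k Tk[OF s1(1)]] C[OF s1(1)] by simp
  then show ?thesis
    using C0 const by (intro that[of "\<alpha> s1 \<bullet> k"]) auto
qed


section \<open>Cones over circles of latitude\<close>

text \<open>The acceleration points to the centre \<open>cos \<phi> a\<close> of the circle: the difference of the two sides is orthogonal
  to \<open>\<alpha> s\<close>, \<open>T s\<close> and \<open>a\<close>. These three vectors span the space, because \<open>a\<close> has the nonzero component
  \<open>\<plusminus> sin \<phi>\<close> along \<open>M s\<close>.\<close>

lemma A_on_latitude_circle:
  assumes a: "norm a = 1" and \<phi>: "sin \<phi> \<noteq> 0"
    and c: "\<And>s. s \<in> I \<Longrightarrow> \<alpha> s \<bullet> a = cos \<phi>" and s: "s \<in> I"
  shows "T s \<bullet> a = 0" "(sin \<phi>)\<^sup>2 *\<^sub>R A s = cos \<phi> *\<^sub>R a - \<alpha> s"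
proof -
  have Ta: "T s \<bullet> a = 0" if "s \<in> I" for s
    by (rule has_vector_derivative_locally_constant[OF open_I that, of "\<lambda>s. \<alpha> s \<bullet> a" "cos \<phi>"])
      (use c that has_vector_derivative_inner[OF deriv_\<alpha> has_vector_derivative_const[of a]] in auto)
  then show "T s \<bullet> a = 0"
    using s by blast
  have Aa: "A s \<bullet> a = 0"
    by (rule has_vector_derivative_locally_constant[OF open_I s, of "\<lambda>s. T s \<bullet> a" 0])
      (use Ta s has_vector_derivative_inner[OF deriv_T has_vector_derivative_const[of a]] in auto)
  define y where "y = (sin \<phi>)\<^sup>2 *\<^sub>R A s - (cos \<phi> *\<^sub>R a - \<alpha> s)"
  have "y \<bullet> \<alpha> s = 0"
    using s c[OF s] by (simp add: y_def inner_diff_left inner_A inner_frame inner_commute[of a]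
        sin_squared_eq flip: power2_eq_square)
  moreover have "y \<bullet> T s = 0"
    using s Ta[OF s] by (simp add: y_def inner_diff_left inner_A inner_frame inner_commute[of a])
  moreover have "y \<bullet> M s = 0"
  proof -
    have "a = cos \<phi> *\<^sub>R \<alpha> s + (a \<bullet> M s) *\<^sub>R M s"
      using frame_expansion[OF s, of a] Ta[OF s] c[OF s] by (simp add: inner_commute)
    then have e: "z \<bullet> a = cos \<phi> * (z \<bullet> \<alpha> s) + (a \<bullet> M s) * (z \<bullet> M s)" for z
      by (metis inner_add_right inner_scaleR_right)
    have "(M s \<bullet> a)\<^sup>2 = (sin \<phi>)\<^sup>2"
      using height_if_tangent_orthogonal[OF s a Ta[OF s]] c[OF s] by (simp add: sin_squared_eq)
    then have "a \<bullet> M s \<noteq> 0"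
      using \<phi> by (auto simp: inner_commute)
    moreover have "y \<bullet> a = 0"
      using a s Aa c[OF s] by (simp add: y_def inner_diff_left norm_eq_1)
    ultimately show ?thesis
      using e[of y] \<open>y \<bullet> \<alpha> s = 0\<close> by simp
  qed
  ultimately have "y = 0"
    using frame_expansion[OF s, of y] by simp
  then show "(sin \<phi>)\<^sup>2 *\<^sub>R A s = cos \<phi> *\<^sub>R a - \<alpha> s"
    by (simp add: y_def)
qed

text \<open>The vector \<open>w\<close> from the centre of the circle satisfies \<open>w'' = - w / \<rho>\<^sup>2\<close> by \<open>A_on_latitude_circle\<close>.
  Instead of a uniqueness theorem for this equation, the proof rotates the pair \<open>(w, \<rho> T)\<close> back by the
  expected angle \<open>h\<close>; the resulting vectors \<open>P\<close> and \<open>Q\<close> have derivative zero.\<close>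

lemma latitude_circle_parametrization:
  assumes a: "norm a = 1" and \<phi>: "sin \<phi> \<noteq> 0"
    and c: "\<And>s. s \<in> I \<Longrightarrow> \<alpha> s \<bullet> a = cos \<phi>" and s: "s \<in> I" "s\<^sub>0 \<in> I"
  defines "\<rho> \<equiv> sin \<phi>"
  shows "\<alpha> s = cos \<phi> *\<^sub>R a + cos ((s - s\<^sub>0) / \<rho>) *\<^sub>R (\<alpha> s\<^sub>0 - cos \<phi> *\<^sub>R a)
                 + (\<rho> * sin ((s - s\<^sub>0) / \<rho>)) *\<^sub>R T s\<^sub>0"
proof -
  define w where "w = (\<lambda>s. \<alpha> s - cos \<phi> *\<^sub>R a)"
  define h where "h = (\<lambda>s. (s - s\<^sub>0) / \<rho>)"
  define P where "P = (\<lambda>s. cos (h s) *\<^sub>R w s - (\<rho> * sin (h s)) *\<^sub>R T s)"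
  define Q where "Q = (\<lambda>s. sin (h s) *\<^sub>R w s + (\<rho> * cos (h s)) *\<^sub>R T s)"
  have \<rho>: "\<rho> \<noteq> 0" using \<phi> by (simp add: \<rho>_def)
  have A: "\<rho> *\<^sub>R A t = - (1 / \<rho>) *\<^sub>R w t" if "t \<in> I" for t
  proof -
    have "\<rho>\<^sup>2 *\<^sub>R A t = - w t"
      using A_on_latitude_circle(2)[OF a \<phi> c that] by (simp add: w_def \<rho>_def)
    then have "(1 / \<rho>) *\<^sub>R (\<rho>\<^sup>2 *\<^sub>R A t) = (1 / \<rho>) *\<^sub>R (- w t)"
      by simp
    then show ?thesis
      using \<rho> by (simp add: power2_eq_square)
  qed
  have dw: "(w has_vector_derivative T t) (at t)" if "t \<in> I" for t
    using has_vector_derivative_diff[OF deriv_\<alpha>[OF that] has_vector_derivative_const] by (simp add: w_def)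
  have dc: "((\<lambda>s. cos (h s)) has_real_derivative - (sin (h t) / \<rho>)) (at t)"
   and ds: "((\<lambda>s. sin (h s)) has_real_derivative cos (h t) / \<rho>) (at t)" for t
    unfolding h_def using \<rho> by (auto intro!: derivative_eq_intros)
  have "(P has_vector_derivative 0) (at t)" if t: "t \<in> I" for t
  proof -
    have "(P has_vector_derivative
        (cos (h t) *\<^sub>R T t + (- (sin (h t) / \<rho>)) *\<^sub>R w t)
        - ((\<rho> * sin (h t)) *\<^sub>R A t + (\<rho> * (cos (h t) / \<rho>)) *\<^sub>R T t)) (at t)"
      unfolding P_def
      by (intro has_vector_derivative_diff has_vector_derivative_scaleR dc dw[OF t] deriv_T[OF t]
          DERIV_cmult ds)
    moreover have "(\<rho> * sin (h t)) *\<^sub>R A t = - (sin (h t) / \<rho>) *\<^sub>R w t"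
      using arg_cong[OF A[OF t], of "\<lambda>x. sin (h t) *\<^sub>R x"] by (simp add: mult.commute)
    ultimately show ?thesis
      using \<rho> by simp
  qed
  then have P: "P s = P s\<^sub>0"
    using constant_on_interval_zero_vector_derivative[OF interval _ s] by blast
  have "(Q has_vector_derivative 0) (at t)" if t: "t \<in> I" for t
  proof -
    have "(Q has_vector_derivative
        (sin (h t) *\<^sub>R T t + (cos (h t) / \<rho>) *\<^sub>R w t)
        + ((\<rho> * cos (h t)) *\<^sub>R A t + (\<rho> * - (sin (h t) / \<rho>)) *\<^sub>R T t)) (at t)"
      unfolding Q_def
      by (intro has_vector_derivative_add has_vector_derivative_scaleR dc dw[OF t] deriv_T[OF t]
          DERIV_cmult ds)
    moreover have "(\<rho> * cos (h t)) *\<^sub>R A t = - (cos (h t) / \<rho>) *\<^sub>R w t"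
      using arg_cong[OF A[OF t], of "\<lambda>x. cos (h t) *\<^sub>R x"] by (simp add: mult.commute)
    ultimately show ?thesis
      using \<rho> by simp
  qed
  then have Q: "Q s = Q s\<^sub>0"
    using constant_on_interval_zero_vector_derivative[OF interval _ s] by blast
  have "cos (h s) *\<^sub>R P s + sin (h s) *\<^sub>R Q s = ((cos (h s))\<^sup>2 + (sin (h s))\<^sup>2) *\<^sub>R w s"
    by (simp add: P_def Q_def scaleR_add_left scaleR_add_right scaleR_diff_right power2_eq_square mult_ac
        del: sin_cos_squared_add sin_cos_squared_add2 sin_cos_squared_add3)
  then have "w s = cos (h s) *\<^sub>R P s + sin (h s) *\<^sub>R Q s"
    by simp
  also have "\<dots> = cos (h s) *\<^sub>R w s\<^sub>0 + (\<rho> * sin (h s)) *\<^sub>R T s\<^sub>0"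
    unfolding P Q by (simp add: P_def Q_def h_def mult.commute)
  finally show ?thesis
    by (simp add: w_def h_def algebra_simps)
qed

text \<open>Near a point \<open>x\<close> with parameters \<open>(s\<^sub>0, v\<^sub>0)\<close> the map \<open>F\<close> recovers the parameters of points of the
  cone: the second component of \<open>F\<close> is the signed distance from the vertex, and the first one is the
  parameter at which \<open>\<alpha>\<close> would reach the ruling, read off from the angle of the ruling relative to \<open>\<alpha> s\<^sub>0\<close>. As
  \<open>F\<close> is continuous on an open set of the space, the points that \<open>F\<close> maps into \<open>I \<times> J\<close> form a neighbourhood.\<close>

lemma openin_circular_cone:
  assumes a: "norm a = 1" and \<phi>: "0 < \<phi>" "\<phi> < pi / 2"
    and c: "\<And>s. s \<in> I \<Longrightarrow> \<alpha> s \<bullet> a = cos \<phi>"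
    and J: "open J" "0 \<notin> J"
  shows "openin (top_of_set (circular_cone 0 a \<phi>)) ((\<lambda>(s, v). v *\<^sub>R \<alpha> s) ` (I \<times> J))" (is "openin ?top ?S")
proof (subst openin_subopen, intro ballI)
  fix x assume "x \<in> ?S"
  then obtain s\<^sub>0 v\<^sub>0 where s0: "s\<^sub>0 \<in> I" and v0: "v\<^sub>0 \<in> J" and x: "x = v\<^sub>0 *\<^sub>R \<alpha> s\<^sub>0"
    by auto
  define \<rho> where "\<rho> = sin \<phi>"
  have \<rho>: "\<rho> > 0" using \<phi> by (simp add: \<rho>_def sin_gt_zero)
  have cos0: "cos \<phi> > 0" using \<phi> by (simp add: cos_gt_zero)
  have \<rho>2: "\<rho>\<^sup>2 = 1 - (cos \<phi>)\<^sup>2" by (simp add: \<rho>_def sin_squared_eq)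
  have aa: "a \<bullet> a = 1" using a by (simp add: norm_eq_1)
  define w where "w = \<alpha> s\<^sub>0 - cos \<phi> *\<^sub>R a"
  have Ta: "T s\<^sub>0 \<bullet> a = 0"
    using A_on_latitude_circle(1)[OF a _ c s0] \<rho> by (simp add: \<rho>_def)
  have w\<alpha>: "w \<bullet> \<alpha> s\<^sub>0 = \<rho>\<^sup>2" and wT: "w \<bullet> T s\<^sub>0 = 0" and wa: "w \<bullet> a = 0" and ww: "w \<bullet> w = \<rho>\<^sup>2"
    using s0 c[OF s0] Ta aa
    by (simp_all add: w_def inner_diff inner_frame inner_commute \<rho>2 flip: power2_eq_square)
  define F where "F = (\<lambda>y. (s\<^sub>0 + \<rho> * arctan (\<rho> * (y \<bullet> T s\<^sub>0) / (y \<bullet> w)), (y \<bullet> a) / cos \<phi>))"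
  \<comment> \<open>For a point of the cone, membership in \<open>H\<close> means that its ruling is less than a quarter turn about
    the axis away from that of \<open>x\<close>, so that \<open>arctan\<close> gives the angle between them; the product is invariant under \<open>y \<mapsto> - y\<close>, so both nappes are covered.\<close>
  define H where "H = {y. 0 < (y \<bullet> a) * (y \<bullet> w)}"
  define U where "U = H \<inter> F -` (I \<times> J)"
  have "open H"
    unfolding H_def by (intro open_Collect_less continuous_intros)
  moreover have "continuous_on H F"
    unfolding F_def H_def using cos0 by (intro continuous_intros) auto
  ultimately have "open U"
    unfolding U_def using J open_I by (intro continuous_open_preimage open_Times)
  have "x \<in> circular_cone 0 a \<phi>"
    using s0 norm_\<alpha> c by (auto simp: circular_cone_def x)
  moreover have "x \<in> U"
  proof -
    have "v\<^sub>0 \<noteq> 0" using v0 J by auto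
    then have "0 < v\<^sub>0\<^sup>2 * (cos \<phi> * \<rho>\<^sup>2)"
      using cos0 \<rho> by simp
    also have "\<dots> = (x \<bullet> a) * (x \<bullet> w)"
      using c[OF s0] w\<alpha> by (simp add: x inner_commute[of _ w] power2_eq_square)
    finally have "(x \<bullet> a) * (x \<bullet> w) > 0" .
    then show ?thesis
      using s0 v0 c[OF s0] cos0 by (simp add: U_def H_def F_def x inner_frame)
  qed
  moreover have "y \<in> ?S" if "y \<in> circular_cone 0 a \<phi>" "y \<in> U" for y
  proof -
    obtain t u where y: "y = t *\<^sub>R u" and u: "norm u = 1" "u \<bullet> a = cos \<phi>"
      using \<open>y \<in> circular_cone 0 a \<phi>\<close> by (auto simp: circular_cone_def)
    define X where "X = (u \<bullet> w) / \<rho>"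
    define Y where "Y = u \<bullet> T s\<^sub>0"
    define h where "h = arctan (Y / X)"
    have "t\<^sup>2 * (cos \<phi> * (u \<bullet> w)) > 0"
      using \<open>y \<in> U\<close> u by (simp add: U_def H_def y mult_ac power2_eq_square)
    then have t: "t \<noteq> 0" and "u \<bullet> w > 0"
      using cos0 by (auto simp: zero_less_mult_iff)
    then have X: "X > 0" using \<rho> by (simp add: X_def)
    have "F y = (s\<^sub>0 + \<rho> * h, t)"
      using t u cos0 \<rho> by (simp add: F_def y h_def X_def Y_def mult.commute)
    then have st: "s\<^sub>0 + \<rho> * h \<in> I" "t \<in> J"
      using \<open>y \<in> U\<close> by (auto simp: U_def)
    define d where "d = u - cos \<phi> *\<^sub>R a"
    define p where "p = (1 / \<rho>) *\<^sub>R w"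
    define m where "m = cross3 p (T s\<^sub>0)"
    have "p \<bullet> p = 1" and pT: "p \<bullet> T s\<^sub>0 = 0"
      using ww wT \<rho> by (simp_all add: p_def power2_eq_square)
    then have "norm p = 1" by (simp add: norm_eq_1)
    note frame = cross3_frame_expansion[OF \<open>norm p = 1\<close> norm_T[OF s0] pT, folded m_def]
    \<comment> \<open>The axis is \<open>\<plusminus> m\<close>, so \<open>p\<close> and \<open>T s\<^sub>0\<close> span the plane of the circle.\<close>
    have am: "a = (a \<bullet> m) *\<^sub>R m"
      using frame[of a] Ta wa by (simp add: p_def inner_commute)
    then have am': "z \<bullet> a = (a \<bullet> m) * (z \<bullet> m)" for z
      by (metis inner_scaleR_right)
    have "d \<bullet> a = 0"
      using u aa by (simp add: d_def inner_diff_left)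
    then have dm: "d \<bullet> m = 0"
      using am'[of d] am'[of a] aa by auto
    have dX: "d \<bullet> p = X" and dY: "d \<bullet> T s\<^sub>0 = Y"
      using wa Ta by (simp_all add: d_def p_def X_def Y_def inner_diff_left inner_commute[of a])
    have d: "d = X *\<^sub>R p + Y *\<^sub>R T s\<^sub>0"
      using frame[of d] dm dX dY by simp
    have "d \<bullet> d = \<rho>\<^sup>2"
      using u aa by (simp add: d_def inner_diff norm_eq_1 inner_commute \<rho>2 flip: power2_eq_square)
    moreover have "d \<bullet> d = X * (d \<bullet> p) + Y * (d \<bullet> T s\<^sub>0)"
      by (subst (2) d) (simp add: inner_add_right)
    ultimately have XY: "X\<^sup>2 + Y\<^sup>2 = \<rho>\<^sup>2"
      by (simp add: dX dY power2_eq_square)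
    have "1 + (Y / X)\<^sup>2 = (\<rho> / X)\<^sup>2"
      using X by (simp add: XY[symmetric] field_simps)
    then have "sqrt (1 + (Y / X)\<^sup>2) = \<rho> / X"
      using X \<rho> by (simp add: real_sqrt_unique)
    then have h: "cos h = X / \<rho>" "sin h = Y / \<rho>"
      using X by (simp_all add: h_def cos_arctan sin_arctan)
    \<comment> \<open>Hence \<open>u\<close> is obtained from \<open>\<alpha> s\<^sub>0\<close> by rotation through \<open>h\<close>, as is \<open>\<alpha> (s\<^sub>0 + \<rho> * h)\<close>.\<close>
    have "\<alpha> (s\<^sub>0 + \<rho> * h) = cos \<phi> *\<^sub>R a + cos h *\<^sub>R w + (\<rho> * sin h) *\<^sub>R T s\<^sub>0"
      using latitude_circle_parametrization[OF a _ c st(1) s0] \<rho> by (simp add: \<rho>_def w_def)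
    also have "\<dots> = cos \<phi> *\<^sub>R a + d"
      using \<rho> by (simp add: d h p_def)
    finally have "y = t *\<^sub>R \<alpha> (s\<^sub>0 + \<rho> * h)"
      by (simp add: y d_def)
    then show ?thesis
      using st by force
  qed
  ultimately show "\<exists>V. openin ?top V \<and> x \<in> V \<and> V \<subseteq> ?S"
    using \<open>open U\<close> by (intro exI[of _ "circular_cone 0 a \<phi> \<inter> U"]) (auto simp: openin_open_Int)
qed

end

section \<open>Conical constant angle surfaces\<close>

theorem proposition4:
  fixes r :: "real \<times> real \<Rightarrow> real ^ 3" and D :: "(real \<times> real) set"
  assumes "conical_surface r D"
    and "constant_angle_surface r D"
    and "\<not> coplanar (r ` D)"
  shows "\<exists>a \<phi>. norm a = 1 \<and> 0 < \<phi> \<and> \<phi> < pi / 2 \<and>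
           openin (top_of_set (circular_cone 0 a \<phi>)) (r ` D)"
proof -
  from assms(1) obtain \<alpha> I J where I: "is_interval I" "open I"
    and smooth: "smooth_curve_on I \<alpha>"
    and norm: "\<And>s. s \<in> I \<Longrightarrow> norm (\<alpha> s) = 1" "\<And>s. s \<in> I \<Longrightarrow> norm (vector_derivative \<alpha> (at s)) = 1"
    and J: "open J" "J \<noteq> {}" "0 \<notin> J" and D: "D = I \<times> J"
    and r: "\<And>s v. s \<in> I \<Longrightarrow> v \<in> J \<Longrightarrow> r (s, v) = v *\<^sub>R \<alpha> s"
    unfolding conical_surface_def by blast
  from smooth obtain A where A: "A 0 = \<alpha>"
    "\<And>n s. s \<in> I \<Longrightarrow> (A n has_vector_derivative A (Suc n) s) (at s)"
    unfolding smooth_curve_on_def by blast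
  have d\<alpha>: "(\<alpha> has_vector_derivative A 1 s) (at s)" if "s \<in> I" for s
    using A(2)[OF that, of 0] A(1) by simp
  interpret unit_speed_spherical_curve \<alpha> "A 1" "A 2" I
  proof
    show "(A 1 has_vector_derivative A 2 s) (at s)" if "s \<in> I" for s
      using A(2)[OF that, of 1] by (simp add: numeral_2_eq_2)
    show "continuous_on I (A 2)"
      using A(2) by (meson continuous_at_imp_continuous_on has_vector_derivative_continuous)
    show "norm (A 1 s) = 1" if "s \<in> I" for s
      using norm(2)[OF that] vector_derivative_at[OF d\<alpha>[OF that]] by simp
  qed (use I d\<alpha> norm in auto)
  have image: "r ` D = (\<lambda>(s, v). v *\<^sub>R \<alpha> s) ` (I \<times> J)"
    unfolding D by (intro image_cong) (auto simp: r)
  from assms(2) obtain N k \<theta> where N: "unit_normal_field r D N" and k: "norm k = 1"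
    and \<theta>: "\<And>p. p \<in> D \<Longrightarrow> N p \<bullet> k = cos \<theta>"
    unfolding constant_angle_surface_def by blast
  obtain v where v: "v \<in> J" "v \<noteq> 0"
    using J by auto
  have angle: "(M s \<bullet> k)\<^sup>2 = (cos \<theta>)\<^sup>2" if s: "s \<in> I" for s
  proof -
    have "((\<lambda>s'. v *\<^sub>R \<alpha> s') has_vector_derivative v *\<^sub>R A 1 s) (at s)"
      by (rule bounded_linear.has_vector_derivative[OF bounded_linear_scaleR_right d\<alpha>[OF s]])
    then have "((\<lambda>s'. r (s', v)) has_vector_derivative v *\<^sub>R A 1 s) (at s)"
      by (rule has_vector_derivative_transform_within_open[OF _ I(2) s]) (simp add: r v)
    moreover have "((\<lambda>v'. v' *\<^sub>R \<alpha> s) has_vector_derivative \<alpha> s) (at v)"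
      by (auto intro!: derivative_eq_intros simp: has_vector_derivative_def)
    then have "((\<lambda>v'. r (s, v')) has_vector_derivative \<alpha> s) (at v)"
      by (rule has_vector_derivative_transform_within_open[OF _ J(1) v(1)]) (simp add: r s)
    moreover have "(s, v) \<in> D"
      using s v D by simp
    ultimately have "norm (N (s, v)) = 1" "N (s, v) \<bullet> \<alpha> s = 0" "N (s, v) \<bullet> A 1 s = 0"
      using N v(2) by (force simp: unit_normal_field_def dest!: vector_derivative_at)+
    then show ?thesis
      using normal_angle[OF s] \<theta>[OF \<open>(s, v) \<in> D\<close>] by metis
  qed
  obtain s1 where "s1 \<in> I" "\<kappa> s1 \<noteq> 0"
  proof (rule ccontr)
    assume "\<not> thesis"
    then have "coplanar {v *\<^sub>R \<alpha> s | s v. s \<in> I}"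
      using that by (intro planar_if_geodesic) blast
    then have "coplanar (r ` D)"
      by (rule coplanar_subset) (auto simp: image)
    then show False using assms(3) by simp
  qed
  from constant_nonzero_height[OF k angle this]
  obtain b where b: "\<And>s. s \<in> I \<Longrightarrow> \<alpha> s \<bullet> k = b" "b \<noteq> 0" "b\<^sup>2 < 1"
    by blast
  \<comment> \<open>The sign turns the axis to the side of \<open>\<alpha>\<close>, so that the opening angle is acute.\<close>
  define a where "a = sgn b *\<^sub>R k"
  define \<phi> where "\<phi> = arccos \<bar>b\<bar>"
  have b1: "\<bar>b\<bar> < 1"
    using b(3) by (simp add: abs_square_less_1)
  have "norm a = 1"
    using k b(2) by (simp add: a_def abs_sgn_eq)
  moreover have "0 < \<phi>" "\<phi> < pi / 2"
    using b1 b(2) arccos_lt_bounded[of "\<bar>b\<bar>"] arccos_less_mono[of "\<bar>b\<bar>" 0] by (simp_all add: \<phi>_def)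
  moreover have "\<alpha> s \<bullet> a = cos \<phi>" if "s \<in> I" for s
    using b(1)[OF that] b1 by (simp add: a_def \<phi>_def sgn_if)
  ultimately show ?thesis
    using openin_circular_cone[of a \<phi> J] J image by metis
qed

end
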